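(* Suppose $f:\mathbb{R}^n\to\mathbb{R}$ is continuous and the level set $[f=\alpha]=\{x\in\mathbb{R}^n:f(x)=\alpha\}$ is nowhere dense for some $\alpha\in\mathbb{R}$. Then $$\forall x,y\in[f=\alpha],\quad x\preceq y\iff\exists\,\overline\ell>0:\ \forall\ell\in(0,\overline\ell],\ \ \overline f(x,\ell)\ge\overline f(y,\ell).$$ If in addition $f$ is locally Lipschitz and definable in an o-minimal structure on the real field, then $$\forall x,y\in[f=\alpha],\quad x\prec y\iff\exists\,\overline\ell>0:\ \forall\ell\in(0,\overline\ell],\ \ \overline f(x,\ell)>\overline f(y,\ell).$$
   Context: For $f:\mathbb{R}^n\to\mathbb{R}$, define $\mathring f,\overline f:\mathbb{R}^n\times[0,\infty)\to\mathbb{R}\cup\{\infty\}$ by $\mathring f(x,r)=\sup_{y\in\overline B_r(x)}|f(y)-f(x)|$ ($\overline B_r(x)$ the closed Euclidean ball) and $\overline f(x,\ell)=d\big(x,\{y\in\mathbb{R}^n:|f(y)-f(x)|\ge\ell\}\big)$, where $d(x,S)=\inf\{|x-y|:y\in S\}$ (so $d(x,\emptyset)=\infty$). The relation $x\preceq y$ means: there exists $\overline r>0$ such that $\mathring f(x,r)\le\mathring f(y,r)$ for all $r\in(0,\overline r]$. The strict relation is $x\prec y$ iff $x\preceq y$ and not $y\preceq x$. A set is nowhere dense if its closure has empty interior. A function is definable if its graph is definable in a fixed, arbitrary o-minimal structure on the real field. *)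

theory Defs
  imports "HOL-Analysis.Analysis"
begin

text \<open>
  The supremum is taken in \<^typ>\<open>ereal\<close>; for \<open>r \<ge> 0\<close> the ball contains \<open>x\<close>, so the value lies in
  \<open>[0, \<infinity>]\<close>.
\<close>

definition f_ring :: "('a::metric_space \<Rightarrow> real) \<Rightarrow> 'a \<Rightarrow> real \<Rightarrow> ereal" where
  "f_ring f x r = (SUP y\<in>cball x r. ereal \<bar>f y - f x\<bar>)"

text \<open>
  Distance to a set with \<open>d(x, {}) = \<infinity>\<close>. The library's \<^const>\<open>infdist\<close> and \<^const>\<open>setdist\<close> are
  real-valued and equal to \<open>0\<close> on the empty set.
\<close>

definition set_edist :: "'a::metric_space \<Rightarrow> 'a set \<Rightarrow> ereal" where
  "set_edist x S = (INF y\<in>S. ereal (dist x y))"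

definition f_bar :: "('a::metric_space \<Rightarrow> real) \<Rightarrow> 'a \<Rightarrow> real \<Rightarrow> ereal" where
  "f_bar f x l = set_edist x {y. l \<le> \<bar>f y - f x\<bar>}"

definition preceq :: "('a::metric_space \<Rightarrow> real) \<Rightarrow> 'a \<Rightarrow> 'a \<Rightarrow> bool" where
  "preceq f x y \<longleftrightarrow> (\<exists>rb>0. \<forall>r\<in>{0<..rb}. f_ring f x r \<le> f_ring f y r)"

definition prec :: "('a::metric_space \<Rightarrow> real) \<Rightarrow> 'a \<Rightarrow> 'a \<Rightarrow> bool" where
  "prec f x y \<longleftrightarrow> preceq f x y \<and> \<not> preceq f y x"

definition nowhere_dense :: "'a::topological_space set \<Rightarrow> bool" where
  "nowhere_dense S \<longleftrightarrow> interior (closure S) = {}"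

text \<open>The library's \<^const>\<open>local_lipschitz\<close> concerns families of functions with a time parameter.\<close>

definition locally_lipschitz :: "('a::metric_space \<Rightarrow> 'b::metric_space) \<Rightarrow> bool" where
  "locally_lipschitz f \<longleftrightarrow> (\<forall>x. \<exists>u>0. \<exists>L. L-lipschitz_on (ball x u) f)"

text \<open>
  A structure assigns to each dimension \<open>m\<close> a family of subsets of \<open>\<real>\<^sup>m\<close>. As \<open>m\<close> varies, the points
  of \<open>\<real>\<^sup>m\<close> are represented by the real lists of length \<open>m\<close>.
\<close>

definition tuples :: "nat \<Rightarrow> real list set" where
  "tuples m = {v. length v = m}"

text \<open>
  O-minimal structures on the field of real numbers, following van den Dries and Miller.
  In the last condition \<^const>\<open>is_interval\<close> covers intervals of all kinds (open, closed, half-open,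
  bounded or not), including singletons.
\<close>

locale o_minimal_structure =
  fixes D :: "nat \<Rightarrow> real list set set"
  assumes subset_tuples: "A \<in> D m \<Longrightarrow> A \<subseteq> tuples m"
    and whole_space: "tuples m \<in> D m"
    and union: "A \<in> D m \<Longrightarrow> B \<in> D m \<Longrightarrow> A \<union> B \<in> D m"
    and complement: "A \<in> D m \<Longrightarrow> tuples m - A \<in> D m"
    and diagonal: "i < j \<Longrightarrow> j < m \<Longrightarrow> {v \<in> tuples m. v ! i = v ! j} \<in> D m"
    and product_right: "A \<in> D m \<Longrightarrow> {v @ [t] | v t. v \<in> A} \<in> D (Suc m)"
    and product_left: "A \<in> D m \<Longrightarrow> {t # v | v t. v \<in> A} \<in> D (Suc m)"
    and projection: "A \<in> D (Suc m) \<Longrightarrow> butlast ` A \<in> D m"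
    and graph_add: "{[a, b, a + b] | a b. True} \<in> D 3"
    and graph_mult: "{[a, b, a * b] | a b. True} \<in> D 3"
    and o_minimal: "(\<lambda>t. [t]) ` T \<in> D 1 \<longleftrightarrow>
      (\<exists>\<I>. finite \<I> \<and> (\<forall>I\<in>\<I>. is_interval I) \<and> T = \<Union>\<I>)"

text \<open>
  The index type \<open>'n\<close> carries no order, so the graph of \<open>f\<close> becomes a set of tuples only after the
  coordinates are enumerated by some bijection \<open>\<sigma>\<close>. The choice is immaterial, because the definable
  sets of a structure are closed under permutations of the coordinates.
\<close>

definition definable_fun :: "(nat \<Rightarrow> real list set set) \<Rightarrow> (real ^ 'n \<Rightarrow> real) \<Rightarrow> bool" where
  "definable_fun D f \<longleftrightarrow>
    (\<exists>\<sigma>. bij_betw \<sigma> {..<CARD('n)} (UNIV :: 'n set) \<and>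
      {map (\<lambda>i. x $ \<sigma> i) [0..<CARD('n)] @ [f x] | x. True} \<in> D (Suc (CARD('n))))"

end

theory Submission
  imports Defs
begin

text \<open>
  For \<open>l > 0\<close> and \<open>r \<ge> 0\<close>, compactness of closed balls gives
  \<open>f_bar f x l \<le> r \<longleftrightarrow> l \<le> f_ring f x r\<close>, so the two functions are generalized inverses of one
  another and an inequality between the germs at \<open>0\<close> of \<open>f_ring f x\<close> and \<open>f_ring f y\<close> becomes the
  reverse inequality between those of \<open>f_bar f x\<close> and \<open>f_bar f y\<close>. Nowhere density ensures that
  \<open>f_ring f x\<close> is positive on \<open>(0, \<infinity>)\<close>.

  For the strict statement it is enough that the set of \<open>l > 0\<close> with \<open>f_bar f y l < f_bar f x l\<close>
  either contains an interval \<open>(0, \<epsilon>]\<close> or is disjoint from one. By o-minimality this holds as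
  soon as the set is definable, and it is, as the projection of a difference of two sets of the form
  \<open>{(l, r). f_bar f x l \<le> r}\<close>.
\<close>

section \<open>Definable predicates and functions\<close>

lemma tuples_0 [simp]: "tuples 0 = {[]}"
  by (auto simp: tuples_def)

context o_minimal_structure
begin

text \<open>Predicates play the role of formulas in \<open>m\<close> free variables, so that
  definability can be derived along the syntax of a formula. Only the values on
  \<open>tuples m\<close> count.\<close>

definition def_pred :: "nat \<Rightarrow> (real list \<Rightarrow> bool) \<Rightarrow> bool" where
  "def_pred m P \<longleftrightarrow> {v \<in> tuples m. P v} \<in> D m"

text \<open>The graph is taken with the value as last coordinate, and \<open>take m\<close> hides
  that coordinate from the argument of \<open>h\<close>.\<close>

definition def_fun :: "nat \<Rightarrow> (real list \<Rightarrow> real) \<Rightarrow> bool" where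
  "def_fun m h \<longleftrightarrow> def_pred (Suc m) (\<lambda>u. u ! m = h (take m u))"

section \<open>Boolean operations and quantifiers\<close>

lemma def_pred_cong:
  assumes "\<And>v. v \<in> tuples m \<Longrightarrow> P v \<longleftrightarrow> Q v"
  shows "def_pred m P \<longleftrightarrow> def_pred m Q"
proof -
  have "{v \<in> tuples m. P v} = {v \<in> tuples m. Q v}"
    using assms by blast
  then show ?thesis
    by (simp add: def_pred_def)
qed

lemma def_pred_mem: "A \<in> D m \<Longrightarrow> def_pred m (\<lambda>v. v \<in> A)"
  using subset_tuples[of A m] by (simp add: def_pred_def Collect_conj_eq Int_absorb1)

lemma def_pred_not: "def_pred m P \<Longrightarrow> def_pred m (\<lambda>v. \<not> P v)"
  using complement[of "{v \<in> tuples m. P v}" m]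
  by (simp add: def_pred_def set_diff_eq conj_commute cong: conj_cong)

lemma def_pred_disj: "def_pred m P \<Longrightarrow> def_pred m Q \<Longrightarrow> def_pred m (\<lambda>v. P v \<or> Q v)"
  using union[of "{v \<in> tuples m. P v}" m "{v \<in> tuples m. Q v}"]
  by (simp add: def_pred_def Un_def conj_disj_distribL)

lemma def_pred_conj: "def_pred m P \<Longrightarrow> def_pred m Q \<Longrightarrow> def_pred m (\<lambda>v. P v \<and> Q v)"
  using def_pred_not[OF def_pred_disj[OF def_pred_not[of m P] def_pred_not[of m Q]]] by simp

lemma def_pred_True: "def_pred m (\<lambda>v. True)"
  using whole_space by (simp add: def_pred_def)

lemma def_pred_all_less:
  "(\<And>i. i < (k::nat) \<Longrightarrow> def_pred m (P i)) \<Longrightarrow> def_pred m (\<lambda>v. \<forall>i<k. P i v)"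
proof (induction k)
  case 0
  then show ?case by (simp add: def_pred_True)
next
  case (Suc k)
  then have "def_pred m (\<lambda>v. P k v \<and> (\<forall>i<k. P i v))"
    by (intro def_pred_conj) auto
  then show ?case
    by (simp add: All_less_Suc)
qed

text \<open>Projection forgets the last coordinate, so the quantified variable has to come
  last.\<close>

lemma def_pred_Ex:
  assumes "def_pred (Suc m) P"
  shows "def_pred m (\<lambda>v. \<exists>t. P (v @ [t]))"
proof -
  have "butlast ` {v \<in> tuples (Suc m). P v} = {v \<in> tuples m. \<exists>t. P (v @ [t])}"
  proof (intro equalityI subsetI)
    fix v assume "v \<in> butlast ` {v \<in> tuples (Suc m). P v}"
    then obtain u where u: "u \<in> tuples (Suc m)" "P u" "v = butlast u"
      by blast
    then obtain t where "u = v @ [t]"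
      by (cases u rule: rev_cases) (auto simp: tuples_def)
    with u(1,2) show "v \<in> {v \<in> tuples m. \<exists>t. P (v @ [t])}"
      by (auto simp: tuples_def)
  next
    fix v assume "v \<in> {v \<in> tuples m. \<exists>t. P (v @ [t])}"
    then obtain t where "v \<in> tuples m" "P (v @ [t])"
      by blast
    then show "v \<in> butlast ` {v \<in> tuples (Suc m). P v}"
      by (intro image_eqI[of _ _ "v @ [t]"]) (auto simp: tuples_def)
  qed
  with projection[OF assms[unfolded def_pred_def]] show ?thesis
    by (simp add: def_pred_def)
qed

text \<open>Eliminates a block of \<open>k\<close> trailing variables one at a time. Each step
  replaces \<open>P\<close> by its projection, hence the generalization over \<open>P\<close> in the
  induction.\<close>

lemma def_pred_Ex_tuples:
  "def_pred (m + k) P \<Longrightarrow> def_pred m (\<lambda>v. \<exists>w\<in>tuples k. P (v @ w))"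
proof (induction k arbitrary: P)
  case 0
  then show ?case by simp
next
  case (Suc k)
  have "def_pred m (\<lambda>v. \<exists>w\<in>tuples k. \<exists>t. P ((v @ w) @ [t]))"
    using Suc by (intro Suc.IH def_pred_Ex) simp
  moreover have "(\<exists>w\<in>tuples k. \<exists>t. P ((v @ w) @ [t])) \<longleftrightarrow> (\<exists>w\<in>tuples (Suc k). P (v @ w))" for v
    unfolding tuples_def mem_Collect_eq Bex_def length_Suc_conv_rev append_assoc by blast
  ultimately show ?case
    by simp
qed

section \<open>Substitution of coordinates and of definable functions\<close>

lemma def_pred_nth_eq:
  assumes "i < m" "j < m"
  shows "def_pred m (\<lambda>v. v ! i = v ! j)"
proof (cases i j rule: linorder_cases)
  case less
  then show ?thesis
    using diagonal[of i j m] assms by (simp add: def_pred_def)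
next
  case equal
  then show ?thesis
    by (simp add: def_pred_True)
next
  case greater
  then show ?thesis
    using diagonal[of j i m] assms by (simp add: def_pred_def eq_commute)
qed

text \<open>Each application of \<open>product_left\<close> adds one dummy variable in
  front.\<close>

lemma def_pred_drop:
  assumes "def_pred k P"
  shows "def_pred (m + k) (\<lambda>v. P (drop m v))"
proof (induction m)
  case 0
  then show ?case using assms by simp
next
  case (Suc m)
  have "{t # v | v t. v \<in> {v \<in> tuples (m + k). P (drop m v)}} =
      {v \<in> tuples (Suc m + k). P (drop (Suc m) v)}"
    by (auto simp: tuples_def length_Suc_conv)
  with product_left[OF Suc[unfolded def_pred_def]] show ?case
    by (simp add: def_pred_def)
qed

text \<open>Append \<open>k\<close> fresh variables satisfying \<open>P\<close>, tie the
  \<open>j\<close>-th of them to coordinate \<open>js ! j\<close> by a diagonal, and project them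
  away. The list \<open>js\<close> may permute, repeat or omit coordinates.\<close>

lemma def_pred_reindex:
  assumes "def_pred k P" "length js = k" "set js \<subseteq> {..<m}"
  shows "def_pred m (\<lambda>v. P (map ((!) v) js))"
proof -
  have js: "js ! j < m" if "j < k" for j
    using assms that by (meson lessThan_iff nth_mem subsetD)
  have "def_pred (m + k) (\<lambda>u. P (drop m u) \<and> (\<forall>j<k. u ! (m + j) = u ! (js ! j)))"
    using js by (intro def_pred_conj def_pred_drop def_pred_all_less def_pred_nth_eq assms)
      (auto simp: trans_less_add1)
  then have "def_pred m (\<lambda>v. \<exists>w\<in>tuples k. P (drop m (v @ w)) \<and>
      (\<forall>j<k. (v @ w) ! (m + j) = (v @ w) ! (js ! j)))"
    by (rule def_pred_Ex_tuples)
  moreover have "(\<exists>w\<in>tuples k. P (drop m (v @ w)) \<and>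
      (\<forall>j<k. (v @ w) ! (m + j) = (v @ w) ! (js ! j))) \<longleftrightarrow> P (map ((!) v) js)"
    if v: "v \<in> tuples m" for v
  proof -
    \<comment> \<open>The equations determine the fresh block \<open>w\<close> completely, so the
      quantifier over it has exactly one candidate.\<close>
    have "(\<forall>j<k. (v @ w) ! (m + j) = (v @ w) ! (js ! j)) \<longleftrightarrow> w = map ((!) v) js"
      if "w \<in> tuples k" for w
      using that v js assms(2) by (auto simp: tuples_def nth_append list_eq_iff_nth_eq)
    moreover have "map ((!) v) js \<in> tuples k"
      using assms(2) by (simp add: tuples_def)
    ultimately show ?thesis
      using v by (auto simp: tuples_def)
  qed
  ultimately show ?thesis
    by (simp cong: def_pred_cong)
qed

lemma map_nth_upt_take: "m \<le> length v \<Longrightarrow> map ((!) v) [0..<m] = take m v"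
  by (simp add: list_eq_iff_nth_eq)

text \<open>The graph of \<open>h\<close> is pulled back along the coordinates
  \<open>0, ..., m - 1, j\<close>; thus the value need not stand directly behind the
  arguments.\<close>

lemma def_pred_nth_eq_fun:
  assumes "def_fun m h" "m \<le> j" "j < n"
  shows "def_pred n (\<lambda>u. u ! j = h (take m u))"
proof -
  have "def_pred n (\<lambda>v. map ((!) v) ([0..<m] @ [j]) ! m = h (take m (map ((!) v) ([0..<m] @ [j]))))"
    using assms by (intro def_pred_reindex[OF assms(1)[unfolded def_fun_def]]) auto
  then show ?thesis
    by (rule def_pred_cong[THEN iffD1, rotated])
      (use assms in \<open>auto simp: tuples_def nth_append map_nth_upt_take\<close>)
qed

text \<open>The construction of \<open>def_pred_reindex\<close> with graphs of definable functions
  in place of diagonals.\<close>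

lemma def_pred_subst:
  assumes "def_pred k P" "\<And>i. i < k \<Longrightarrow> def_fun m (h i)"
  shows "def_pred m (\<lambda>v. P (map (\<lambda>i. h i v) [0..<k]))"
proof -
  have "def_pred (m + k) (\<lambda>u. P (drop m u) \<and> (\<forall>j<k. u ! (m + j) = h j (take m u)))"
    by (intro def_pred_conj def_pred_drop def_pred_all_less def_pred_nth_eq_fun assms) auto
  then have "def_pred m (\<lambda>v. \<exists>w\<in>tuples k. P (drop m (v @ w)) \<and>
      (\<forall>j<k. (v @ w) ! (m + j) = h j (take m (v @ w))))"
    by (rule def_pred_Ex_tuples)
  moreover have "(\<exists>w\<in>tuples k. P (drop m (v @ w)) \<and>
      (\<forall>j<k. (v @ w) ! (m + j) = h j (take m (v @ w)))) \<longleftrightarrow> P (map (\<lambda>i. h i v) [0..<k])"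
    if v: "v \<in> tuples m" for v
  proof -
    have "(\<forall>j<k. (v @ w) ! (m + j) = h j (take m (v @ w))) \<longleftrightarrow> w = map (\<lambda>i. h i v) [0..<k]"
      if "w \<in> tuples k" for w
      using that v by (auto simp: tuples_def nth_append list_eq_iff_nth_eq)
    moreover have "map (\<lambda>i. h i v) [0..<k] \<in> tuples k"
      by (simp add: tuples_def)
    ultimately show ?thesis
      using v by (auto simp: tuples_def)
  qed
  ultimately show ?thesis
    by (simp cong: def_pred_cong)
qed

lemma def_fun_nth: "i < m \<Longrightarrow> def_fun m (\<lambda>v. v ! i)"
  unfolding def_fun_def using def_pred_nth_eq[of m "Suc m" i] by simp

lemma def_fun_take:
  assumes "def_fun m h"
  shows "def_fun (m + k) (\<lambda>v. h (take m v))"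
proof -
  have "def_pred (Suc (m + k)) (\<lambda>u. u ! (m + k) = h (take m u))"
    using assms by (intro def_pred_nth_eq_fun) auto
  then show ?thesis
    by (simp add: def_fun_def min_absorb1)
qed

lemma def_fun_compose:
  assumes g: "def_fun k g" and h: "\<And>i. i < k \<Longrightarrow> def_fun m (h i)"
  shows "def_fun m (\<lambda>v. g (map (\<lambda>i. h i v) [0..<k]))"
proof -
  \<comment> \<open>The graph of the composite arises by substitution into the graph of
    \<open>g\<close>: the first \<open>k\<close> components are the inner functions, which ignore
    the value coordinate \<open>u ! m\<close>, and component \<open>k\<close> is that coordinate
    itself.\<close>
  define h' where "h' i = (if i < k then (\<lambda>u. h i (take m u)) else (\<lambda>u. u ! m))" for i
  have "def_fun (Suc m) (h' i)" for i
    using def_fun_take[OF h, of i 1] def_fun_nth[of m "Suc m"] by (simp add: h'_def)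
  then have "def_pred (Suc m) (\<lambda>u. map (\<lambda>i. h' i u) [0..<Suc k] ! k =
      g (take k (map (\<lambda>i. h' i u) [0..<Suc k])))"
    by (intro def_pred_subst[OF g[unfolded def_fun_def]])
  moreover have "map (\<lambda>i. h' i u) [0..<Suc k] = map (\<lambda>i. h i (take m u)) [0..<k] @ [u ! m]" for u
    by (simp add: h'_def)
  ultimately show ?thesis
    by (simp add: def_fun_def nth_append del: upt_Suc)
qed

section \<open>Intervals, constants, arithmetic and order\<close>

text \<open>This is the converse half of \<open>o_minimal\<close>. It admits arbitrary real
  endpoints and is how real parameters enter definable formulas.\<close>

lemma def_pred_interval: "is_interval I \<Longrightarrow> def_pred 1 (\<lambda>v. v ! 0 \<in> I)"
proof -
  assume "is_interval I"
  then have "(\<lambda>t. [t]) ` I \<in> D 1"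
    unfolding o_minimal by (intro exI[of _ "{I}"]) auto
  moreover have "(\<lambda>t. [t]) ` I = {v \<in> tuples 1. v ! 0 \<in> I}"
    by (auto simp: tuples_def length_Suc_conv)
  ultimately show ?thesis
    by (simp add: def_pred_def)
qed

lemma def_pred_fun_interval: "is_interval I \<Longrightarrow> def_fun m h \<Longrightarrow> def_pred m (\<lambda>v. h v \<in> I)"
  using def_pred_subst[OF def_pred_interval, of I m "\<lambda>_. h"] by simp

text \<open>The singleton \<open>{c}\<close> is an interval, and the graph asks the last coordinate
  to lie in it.\<close>

lemma def_fun_const: "def_fun m (\<lambda>v. c)"
  using def_pred_fun_interval[OF _ def_fun_nth, of "{c}" m "Suc m"]
  by (simp add: def_fun_def is_interval_1)

lemma def_fun_binop:
  assumes "{[a, b, op a b] | a b. True} \<in> D 3" "def_fun m g" "def_fun m h"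
  shows "def_fun m (\<lambda>v. op (g v) (h v))"
proof -
  have "def_fun 2 (\<lambda>u. op (u ! 0) (u ! 1))"
    unfolding def_fun_def eval_nat_numeral
    by (rule def_pred_cong[THEN iffD1, OF _ def_pred_mem[OF assms(1), unfolded eval_nat_numeral]])
      (auto simp: tuples_def length_Suc_conv)
  then have "def_fun m (\<lambda>v. (\<lambda>u. op (u ! 0) (u ! 1)) (map (\<lambda>i. (if i = 0 then g else h) v) [0..<2]))"
    using assms by (intro def_fun_compose) auto
  then show ?thesis
    by (simp add: eval_nat_numeral)
qed

lemmas def_fun_add = def_fun_binop[OF graph_add]
lemmas def_fun_mult = def_fun_binop[OF graph_mult]

lemma def_fun_diff: "def_fun m g \<Longrightarrow> def_fun m h \<Longrightarrow> def_fun m (\<lambda>v. g v - h v)"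
  using def_fun_add[OF _ def_fun_mult[OF def_fun_const[of m "-1"]], of g h] by simp

lemma def_fun_sum: "(\<And>i. i < (k::nat) \<Longrightarrow> def_fun m (h i)) \<Longrightarrow> def_fun m (\<lambda>v. \<Sum>i<k. h i v)"
  by (induction k) (auto intro: def_fun_const def_fun_add)

text \<open>The order is recovered from subtraction and the interval \<open>{0..}\<close>.\<close>

lemma def_pred_le:
  assumes "def_fun m g" "def_fun m h"
  shows "def_pred m (\<lambda>v. g v \<le> h v)"
  using def_pred_fun_interval[OF is_interval_ci def_fun_diff[OF assms(2,1)], of 0] by simp

section \<open>Definable sets of reals near 0\<close>

text \<open>A finite union of intervals cannot oscillate at 0: an interval that meets every
  \<open>{0<..e}\<close> already contains one of them. The proof adds the intervals one by
  one.\<close>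

lemma definable_near_0_dichotomy:
  assumes "def_pred 1 (\<lambda>v. P (v ! 0))"
  shows "(\<exists>e>0. \<forall>t\<in>{0<..e}. P t) \<or> (\<exists>e>0. \<forall>t\<in>{0<..e}. \<not> P t)"
proof -
  have "{v \<in> tuples 1. P (v ! 0)} = (\<lambda>t. [t]) ` {t. P t}"
    by (auto simp: tuples_def length_Suc_conv)
  with assms have "(\<lambda>t. [t]) ` {t. P t} \<in> D 1"
    by (simp add: def_pred_def)
  then obtain \<I> where \<I>: "finite \<I>" "\<And>I. I \<in> \<I> \<Longrightarrow> is_interval I" "{t. P t} = \<Union>\<I>"
    unfolding o_minimal by blast
  have "(\<exists>e>0. {0<..e} \<subseteq> \<Union>\<I>) \<or> (\<exists>e>0. {0<..e} \<inter> \<Union>\<I> = {})"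
    using \<I>(1,2)
  proof (induction \<I>)
    case empty
    have "\<exists>e::real. e > 0"
      using zero_less_one by blast
    then show ?case by simp
  next
    case (insert I \<I>)
    show ?case
    proof (cases "\<exists>e>0. {0<..e} \<inter> I = {}")
      case True
      then obtain e where e: "e > 0" "{0<..e} \<inter> I = {}" by blast
      from insert consider "\<exists>e>0. {0<..e} \<subseteq> \<Union>\<I>" | "\<exists>e>0. {0<..e} \<inter> \<Union>\<I> = {}"
        by auto
      then show ?thesis
      proof cases
        case 1
        then show ?thesis by auto
      next
        case 2
        then obtain d where "d > 0" "{0<..d} \<inter> \<Union>\<I> = {}" by blast
        with e have "min d e > 0" "{0<..min d e} \<inter> \<Union>(insert I \<I>) = {}"
          by auto
        then show ?thesis by blast
      qed
    next
      case False
      then have near: "\<exists>s\<in>I. 0 < s \<and> s \<le> e" if "e > 0" for e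
        using that by fastforce
      from near[of 1] obtain b where b: "b \<in> I" "0 < b" by auto
      \<comment> \<open>A point of \<open>I\<close> in \<open>{0<..t}\<close> and the point
        \<open>b\<close> enclose \<open>t\<close>, so convexity applies.\<close>
      have "t \<in> I" if "0 < t" "t \<le> b" for t
        using near[OF that(1)] b that insert.prems[of I] unfolding is_interval_1 by blast
      then show ?thesis
        using b by (intro disjI1 exI[of _ b]) auto
    qed
  qed
  with \<I>(3) show ?thesis
    by blast
qed

end

section \<open>The functions \<open>f_ring\<close> and \<open>f_bar\<close>\<close>

text \<open>The set in \<open>f_bar\<close> is closed by continuity, so its distance from
  \<open>x\<close> is attained once it is nonempty. A finite bound excludes the empty set, where the
  distance is infinite.\<close>

lemma f_bar_le_iff:
  fixes f :: "'a::euclidean_space \<Rightarrow> real"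
  assumes "continuous_on UNIV f"
  shows "f_bar f x l \<le> ereal r \<longleftrightarrow> (\<exists>y. dist x y \<le> r \<and> l \<le> \<bar>f y - f x\<bar>)"
proof
  assume le: "f_bar f x l \<le> ereal r"
  let ?S = "{y. l \<le> \<bar>f y - f x\<bar>}"
  have "closed ?S"
    by (intro closed_Collect_le continuous_intros assms)
  moreover have "?S \<noteq> {}"
  proof
    assume "?S = {}"
    then have "f_bar f x l = \<infinity>"
      unfolding f_bar_def set_edist_def by (simp add: top_ereal_def)
    with le show False by simp
  qed
  ultimately obtain y where y: "y \<in> ?S" "\<And>z. z \<in> ?S \<Longrightarrow> dist x y \<le> dist x z"
    using distance_attains_inf[of ?S x] by blast
  then have "ereal (dist x y) \<le> f_bar f x l"
    unfolding f_bar_def set_edist_def by (intro INF_greatest) auto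
  from this le have "ereal (dist x y) \<le> ereal r"
    by (rule order_trans)
  with y show "\<exists>y. dist x y \<le> r \<and> l \<le> \<bar>f y - f x\<bar>"
    by auto
next
  assume "\<exists>y. dist x y \<le> r \<and> l \<le> \<bar>f y - f x\<bar>"
  then obtain y where y: "dist x y \<le> r" "l \<le> \<bar>f y - f x\<bar>" by blast
  then have "f_bar f x l \<le> ereal (dist x y)"
    unfolding f_bar_def set_edist_def by (intro INF_lower) auto
  with y show "f_bar f x l \<le> ereal r"
    by (meson ereal_less_eq(3) order_trans)
qed

lemma f_ring_attained:
  fixes f :: "'a::heine_borel \<Rightarrow> real"
  assumes "continuous_on UNIV f" "0 \<le> r"
  obtains y where "dist x y \<le> r" "f_ring f x r = ereal \<bar>f y - f x\<bar>"
proof -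
  have "continuous_on (cball x r) (\<lambda>y. \<bar>f y - f x\<bar>)"
    by (intro continuous_intros continuous_on_subset[OF assms(1)]) auto
  then obtain y where y: "y \<in> cball x r" "\<And>z. z \<in> cball x r \<Longrightarrow> \<bar>f z - f x\<bar> \<le> \<bar>f y - f x\<bar>"
    using continuous_attains_sup[of "cball x r" "\<lambda>y. \<bar>f y - f x\<bar>"] assms(2)
    by (metis cball_eq_empty compact_cball not_less)
  then have "f_ring f x r = ereal \<bar>f y - f x\<bar>"
    unfolding f_ring_def by (intro antisym SUP_least SUP_upper) auto
  with y that show ?thesis by simp
qed

text \<open>Both sides say that some point of \<open>cball x r\<close> has deviation at least
  \<open>l\<close>. Attainment of the infimum and of the supremum makes the two weak inequalities
  match exactly.\<close>

lemma f_bar_le_iff_f_ring_ge: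
  fixes f :: "'a::euclidean_space \<Rightarrow> real"
  assumes "continuous_on UNIV f" "0 \<le> r"
  shows "f_bar f x l \<le> ereal r \<longleftrightarrow> ereal l \<le> f_ring f x r"
proof -
  obtain y where y: "dist x y \<le> r" "f_ring f x r = ereal \<bar>f y - f x\<bar>"
    using f_ring_attained[OF assms] .
  have "\<bar>f z - f x\<bar> \<le> \<bar>f y - f x\<bar>" if "dist x z \<le> r" for z
    using SUP_upper[of z "cball x r" "\<lambda>z. ereal \<bar>f z - f x\<bar>"] that y(2)
    by (simp add: f_ring_def)
  with y show ?thesis
    unfolding f_bar_le_iff[OF assms(1)] by fastforce
qed

text \<open>No ball fits into a nowhere dense level set, so \<open>f\<close> takes a value other
  than \<open>f x\<close> in every ball around \<open>x\<close>.\<close>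

lemma f_ring_pos:
  fixes f :: "'a::{heine_borel, perfect_space} \<Rightarrow> real"
  assumes "nowhere_dense {z. f z = f x}" "0 < r"
  shows "0 < f_ring f x r"
proof -
  have "\<not> ball x r \<subseteq> {z. f z = f x}"
    using assms interior_maximal[of "ball x r" "closure {z. f z = f x}"] closure_subset
    unfolding nowhere_dense_def by fastforce
  then obtain z where z: "z \<in> cball x r" "f z \<noteq> f x"
    using ball_subset_cball by blast
  then have "0 < ereal \<bar>f z - f x\<bar>"
    by simp
  also have "\<dots> \<le> f_ring f x r"
    unfolding f_ring_def using z by (intro SUP_upper)
  finally show ?thesis .
qed

lemma f_ring_small:
  fixes f :: "'a::metric_space \<Rightarrow> real"
  assumes "continuous_on UNIV f" "0 < l"
  obtains rb where "rb > 0" "\<And>r. r \<le> rb \<Longrightarrow> f_ring f x r \<le> ereal l"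
proof -
  obtain d where d: "d > 0" "\<And>y. dist y x < d \<Longrightarrow> dist (f y) (f x) < l"
    using assms unfolding continuous_on_iff by (metis UNIV_I)
  show ?thesis
  proof
    \<comment> \<open>Halving puts the closed ball inside the open ball of radius \<open>d\<close>.
      For negative \<open>r\<close> the ball is empty and its supremum is minus infinity.\<close>
    show "d / 2 > 0" using d by simp
    fix r assume "r \<le> d / 2"
    then show "f_ring f x r \<le> ereal l"
      unfolding f_ring_def using d
      by (intro SUP_least) (auto simp: dist_real_def dist_commute intro!: less_imp_le)
  qed
qed

text \<open>Each direction evaluates its hypothesis at one well-chosen point: the radius
  \<open>f_bar f x l\<close> in the first, the level \<open>f_ring f x r\<close> in the second. The
  rest is \<open>f_bar_le_iff_f_ring_ge\<close>.\<close>

lemma preceq_iff_f_bar_ge: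
  fixes f :: "'a::euclidean_space \<Rightarrow> real"
  assumes f: "continuous_on UNIV f" and nd: "nowhere_dense {z. f z = f x}"
  shows "preceq f x y \<longleftrightarrow> (\<exists>lb>0. \<forall>l\<in>{0<..lb}. f_bar f x l \<ge> f_bar f y l)"
proof
  assume "preceq f x y"
  then obtain rb where rb: "rb > 0" "\<And>r. 0 < r \<Longrightarrow> r \<le> rb \<Longrightarrow> f_ring f x r \<le> f_ring f y r"
    unfolding preceq_def by auto
  \<comment> \<open>With this \<open>lb\<close>, every level \<open>l \<le> lb\<close> is reached
    within radius \<open>rb\<close>, so \<open>f_bar f x l\<close> stays in the range where the
    hypothesis holds.\<close>
  obtain lb where lb: "f_ring f x rb = ereal lb"
    using f_ring_attained[OF f, of rb x] rb(1) by (metis less_imp_le)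
  have "lb > 0"
    using f_ring_pos[OF nd rb(1)] lb by simp
  moreover have "f_bar f y l \<le> f_bar f x l" if l: "0 < l" "l \<le> lb" for l
  proof -
    have le: "f_bar f x l \<le> ereal rb"
      using f_bar_le_iff_f_ring_ge[OF f, of rb x l] lb l rb(1) by simp
    \<comment> \<open>Radius 0 leaves only the point \<open>x\<close>, whose deviation 0 is below
      \<open>l\<close>.\<close>
    have "\<not> f_bar f x l \<le> ereal 0"
      using l unfolding f_bar_le_iff[OF f] by auto
    with le obtain r where r: "f_bar f x l = ereal r" "0 < r" "r \<le> rb"
      by (cases "f_bar f x l") auto
    then have "ereal l \<le> f_ring f x r"
      using f_bar_le_iff_f_ring_ge[OF f, of r x l] by simp
    also have "\<dots> \<le> f_ring f y r"
      using rb(2) r by simp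
    finally show ?thesis
      using f_bar_le_iff_f_ring_ge[OF f, of r y l] r by simp
  qed
  ultimately show "\<exists>lb>0. \<forall>l\<in>{0<..lb}. f_bar f x l \<ge> f_bar f y l"
    by auto
next
  assume "\<exists>lb>0. \<forall>l\<in>{0<..lb}. f_bar f x l \<ge> f_bar f y l"
  then obtain lb where lb: "lb > 0" "\<And>l. 0 < l \<Longrightarrow> l \<le> lb \<Longrightarrow> f_bar f y l \<le> f_bar f x l"
    by auto
  \<comment> \<open>Continuity keeps the level \<open>f_ring f x r\<close> at most
    \<open>lb\<close>; it is positive by \<open>f_ring_pos\<close>.\<close>
  obtain rb where rb: "rb > 0" "\<And>r. r \<le> rb \<Longrightarrow> f_ring f x r \<le> ereal lb"
    using f_ring_small[OF f lb(1)] by blast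
  have "f_ring f x r \<le> f_ring f y r" if r: "0 < r" "r \<le> rb" for r
  proof -
    obtain l where l: "f_ring f x r = ereal l"
      using f_ring_attained[OF f, of r x] r(1) by (metis less_imp_le)
    then have "0 < l" "l \<le> lb"
      using f_ring_pos[OF nd r(1)] rb(2)[OF r(2)] by auto
    then have "f_bar f y l \<le> f_bar f x l"
      by (rule lb(2))
    also have "\<dots> \<le> ereal r"
      using f_bar_le_iff_f_ring_ge[OF f, of r x l] r l by simp
    finally show ?thesis
      using f_bar_le_iff_f_ring_ge[OF f, of r y l] r l by simp
  qed
  with rb(1) show "preceq f x y"
    unfolding preceq_def by auto
qed

section \<open>Definability of comparisons between values of \<open>f_bar\<close>\<close>

text \<open>By \<open>f_bar_le_iff\<close> the condition is an existential formula over the points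
  of the space. Coordinate 0 is the level, coordinate 1 the radius, and the coordinates from 2 on
  encode the point.\<close>

lemma (in o_minimal_structure) def_pred_f_bar_le:
  fixes f :: "real ^ 'n \<Rightarrow> real"
  assumes f: "continuous_on UNIV f" and D: "definable_fun D f"
  shows "def_pred 2 (\<lambda>v. f_bar f x (v ! 0) \<le> ereal (v ! 1))"
proof -
  let ?n = "CARD('n)"
  obtain \<sigma> where \<sigma>: "bij_betw \<sigma> {..<?n} (UNIV :: 'n set)"
    and graph: "{map (\<lambda>i. z $ \<sigma> i) [0..<?n] @ [f z] | z. True} \<in> D (Suc ?n)"
    using D unfolding definable_fun_def by blast
  \<comment> \<open>\<open>tup\<close> and \<open>vec\<close> are mutually inverse identifications
    of vectors with tuples along the enumeration \<open>\<sigma>\<close>.\<close>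
  define tup where "tup z = map (\<lambda>i. z $ \<sigma> i) [0..<?n]" for z :: "real ^ 'n"
  define vec where "vec w = (\<chi> j. w ! inv_into {..<?n} \<sigma> j)" for w :: "real list"
  have vec_nth: "vec w $ \<sigma> i = w ! i" if "i < ?n" for w i
    using that \<sigma> by (simp add: vec_def bij_betw_def inv_into_f_f)
  have tup_vec: "tup (vec w) = w" if "w \<in> tuples ?n" for w
    using that by (auto simp: tup_def tuples_def vec_nth list_eq_iff_nth_eq)
  have vec_tup: "vec (tup z) = z" for z
  proof (rule vec_eq_iff[THEN iffD2], rule allI)
    fix j
    obtain i where "i < ?n" "j = \<sigma> i"
      using \<sigma> unfolding bij_betw_def by blast
    then show "vec (tup z) $ j = z $ j"
      by (simp add: vec_nth) (simp add: tup_def)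
  qed
  have tup: "tup z \<in> tuples ?n" for z
    by (simp add: tup_def tuples_def)
  have "def_fun ?n (\<lambda>w. f (vec w))"
    unfolding def_fun_def
  proof (rule def_pred_cong[THEN iffD1, OF _ def_pred_mem[OF graph]])
    fix u assume u: "u \<in> tuples (Suc ?n)"
    then have "u = take ?n u @ [u ! ?n]"
      by (metis (mono_tags) lessI mem_Collect_eq order_refl take_Suc_conv_app_nth take_all tuples_def)
    moreover have "take ?n u \<in> tuples ?n"
      using u by (auto simp: tuples_def)
    ultimately show "u \<in> {map (\<lambda>i. z $ \<sigma> i) [0..<?n] @ [f z] | z. True} \<longleftrightarrow>
        u ! ?n = f (vec (take ?n u))"
      unfolding tup_def[symmetric] using tup_vec vec_tup
      by (smt (verit, best) append1_eq_conv mem_Collect_eq)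
  qed
  then have "def_fun (2 + ?n) (\<lambda>u. f (vec (map (\<lambda>i. u ! (2 + i)) [0..<?n])))"
    by (rule def_fun_compose) (simp add: def_fun_nth)
  \<comment> \<open>The distance bound is squared, with \<open>0 \<le> u ! 1\<close> to make this
    reversible, and the absolute value is split into two cases. Only field operations, order,
    constants and \<open>f\<close> remain.\<close>
  then have "def_pred (2 + ?n) (\<lambda>u. 0 \<le> u ! 1 \<and>
      (\<Sum>i<?n. (x $ \<sigma> i - u ! (2 + i)) * (x $ \<sigma> i - u ! (2 + i))) \<le> u ! 1 * u ! 1 \<and>
      (u ! 0 \<le> f (vec (map (\<lambda>i. u ! (2 + i)) [0..<?n])) - f x \<or>
       u ! 0 \<le> f x - f (vec (map (\<lambda>i. u ! (2 + i)) [0..<?n]))))"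
    by (intro def_pred_conj def_pred_disj def_pred_le def_fun_const def_fun_diff def_fun_sum
        def_fun_mult def_fun_nth) auto
  then have "def_pred 2 (\<lambda>v. \<exists>w\<in>tuples ?n. 0 \<le> (v @ w) ! 1 \<and>
      (\<Sum>i<?n. (x $ \<sigma> i - (v @ w) ! (2 + i)) * (x $ \<sigma> i - (v @ w) ! (2 + i)))
        \<le> (v @ w) ! 1 * (v @ w) ! 1 \<and>
      ((v @ w) ! 0 \<le> f (vec (map (\<lambda>i. (v @ w) ! (2 + i)) [0..<?n])) - f x \<or>
       (v @ w) ! 0 \<le> f x - f (vec (map (\<lambda>i. (v @ w) ! (2 + i)) [0..<?n]))))"
    (is "def_pred 2 (\<lambda>v. \<exists>w\<in>tuples ?n. ?Q v w)")
    by (rule def_pred_Ex_tuples)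
  moreover have "(\<exists>w\<in>tuples ?n. ?Q v w) \<longleftrightarrow> f_bar f x (v ! 0) \<le> ereal (v ! 1)"
    if v: "v \<in> tuples 2" for v
  proof -
    have Q: "?Q v w \<longleftrightarrow> dist x (vec w) \<le> v ! 1 \<and> v ! 0 \<le> \<bar>f (vec w) - f x\<bar>"
      if w: "w \<in> tuples ?n" for w
    proof -
      have app: "(v @ w) ! 0 = v ! 0" "(v @ w) ! 1 = v ! 1" "\<And>i. (v @ w) ! (2 + i) = w ! i"
        using v by (auto simp: tuples_def nth_append)
      have w_eq: "map (\<lambda>i. w ! i) [0..<?n] = w"
        using w map_nth[of w] by (simp add: tuples_def)
      have "(dist x (vec w))\<^sup>2 = (\<Sum>j\<in>UNIV. (x $ j - vec w $ j)\<^sup>2)"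
        by (simp add: dist_norm norm_vec_def L2_set_def sum_nonneg)
      also have "\<dots> = (\<Sum>i<?n. (x $ \<sigma> i - vec w $ \<sigma> i)\<^sup>2)"
        using sum.reindex_bij_betw[OF \<sigma>, of "\<lambda>j. (x $ j - vec w $ j)\<^sup>2"] by simp
      also have "\<dots> = (\<Sum>i<?n. (x $ \<sigma> i - w ! i) * (x $ \<sigma> i - w ! i))"
        by (simp add: vec_nth power2_eq_square)
      finally have d: "(\<Sum>i<?n. (x $ \<sigma> i - w ! i) * (x $ \<sigma> i - w ! i)) = (dist x (vec w))\<^sup>2"
        by simp
      have "0 \<le> v ! 1 \<and> (dist x (vec w))\<^sup>2 \<le> v ! 1 * v ! 1 \<longleftrightarrow> dist x (vec w) \<le> v ! 1"
        unfolding power2_eq_square[symmetric]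
        by (meson order_trans power2_le_imp_le power_mono zero_le_dist)
      then show ?thesis
        unfolding app w_eq d by (auto simp: abs_real_def)
    qed
    show ?thesis
    proof
      assume "\<exists>w\<in>tuples ?n. ?Q v w"
      then show "f_bar f x (v ! 0) \<le> ereal (v ! 1)"
        unfolding f_bar_le_iff[OF f] using Q by blast
    next
      assume "f_bar f x (v ! 0) \<le> ereal (v ! 1)"
      then obtain z where "dist x z \<le> v ! 1" "v ! 0 \<le> \<bar>f z - f x\<bar>"
        unfolding f_bar_le_iff[OF f] by blast
      then have "?Q v (tup z)"
        unfolding Q[OF tup] vec_tup by blast
      with tup show "\<exists>w\<in>tuples ?n. ?Q v w"
        by blast
    qed
  qed
  ultimately show ?thesis
    by (rule def_pred_cong[THEN iffD1, rotated])
qed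

text \<open>A strict inequality between the two extended reals is witnessed by a real
  \<open>r\<close> with \<open>f_bar f y l \<le> r < f_bar f x l\<close>, and \<open>r\<close> is
  then projected away.\<close>

lemma (in o_minimal_structure) def_pred_f_bar_less:
  fixes f :: "real ^ 'n \<Rightarrow> real"
  assumes f: "continuous_on UNIV f" and D: "definable_fun D f"
  shows "def_pred 1 (\<lambda>v. f_bar f y (v ! 0) < f_bar f x (v ! 0))"
proof -
  have "def_pred (Suc 1) (\<lambda>u. f_bar f y (u ! 0) \<le> ereal (u ! 1) \<and>
      \<not> f_bar f x (u ! 0) \<le> ereal (u ! 1))"
    using def_pred_conj[OF def_pred_f_bar_le[OF f D] def_pred_not[OF def_pred_f_bar_le[OF f D]]]
    by (simp add: numeral_2_eq_2)
  from def_pred_Ex[OF this] show ?thesis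
  proof (rule def_pred_cong[THEN iffD1, rotated])
    fix v :: "real list" assume "v \<in> tuples 1"
    then obtain l where v: "v = [l]"
      by (auto simp: tuples_def length_Suc_conv)
    have "(\<exists>r. f_bar f y l \<le> ereal r \<and> ereal r < f_bar f x l) \<longleftrightarrow> f_bar f y l < f_bar f x l"
    proof
      assume less: "f_bar f y l < f_bar f x l"
      have "0 \<le> f_bar f y l"
        unfolding f_bar_def set_edist_def by (intro INF_greatest) simp
      \<comment> \<open>Nonnegativity excludes minus infinity and \<open>less\<close> excludes
        infinity, so \<open>f_bar f y l\<close> is itself a real witness.\<close>
      with less obtain r where "f_bar f y l = ereal r"
        by (cases "f_bar f y l") auto
      with less show "\<exists>r. f_bar f y l \<le> ereal r \<and> ereal r < f_bar f x l"
        by auto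
    qed (auto intro: le_less_trans)
    then show "(\<exists>t. f_bar f y ((v @ [t]) ! 0) \<le> ereal ((v @ [t]) ! 1) \<and>
        \<not> f_bar f x ((v @ [t]) ! 0) \<le> ereal ((v @ [t]) ! 1)) \<longleftrightarrow>
        f_bar f y (v ! 0) < f_bar f x (v ! 0)"
      by (simp add: v not_le)
  qed
qed

section \<open>Weak and strict comparison on a common level set\<close>

theorem proposition3p12:
  fixes f :: "real ^ 'n \<Rightarrow> real" and \<alpha> :: real
  assumes "continuous_on UNIV f"
    and "nowhere_dense {x. f x = \<alpha>}"
  shows "(\<forall>x\<in>{x. f x = \<alpha>}. \<forall>y\<in>{x. f x = \<alpha>}.
            preceq f x y \<longleftrightarrow> (\<exists>lb>0. \<forall>l\<in>{0<..lb}. f_bar f x l \<ge> f_bar f y l)) \<and>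
         (\<forall>D. locally_lipschitz f \<and> o_minimal_structure D \<and> definable_fun D f \<longrightarrow>
            (\<forall>x\<in>{x. f x = \<alpha>}. \<forall>y\<in>{x. f x = \<alpha>}.
              prec f x y \<longleftrightarrow> (\<exists>lb>0. \<forall>l\<in>{0<..lb}. f_bar f x l > f_bar f y l)))"
proof -
  have weak: "preceq f x y \<longleftrightarrow> (\<exists>lb>0. \<forall>l\<in>{0<..lb}. f_bar f x l \<ge> f_bar f y l)"
    if "f x = \<alpha>" for x y
    using preceq_iff_f_bar_ge[OF assms(1)] assms(2) that by blast
  have strict: "prec f x y \<longleftrightarrow> (\<exists>lb>0. \<forall>l\<in>{0<..lb}. f_bar f x l > f_bar f y l)"
    if D: "o_minimal_structure D" "definable_fun D f" and xy: "f x = \<alpha>" "f y = \<alpha>" for D x y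
  proof
    interpret o_minimal_structure D by (rule D)
    assume "prec f x y"
    \<comment> \<open>The failure of \<open>preceq f y x\<close> only yields arbitrarily small
      \<open>l\<close> with strict inequality. The dichotomy for definable sets upgrades this to all
      small \<open>l\<close>.\<close>
    then have "\<not> (\<exists>lb>0. \<forall>l\<in>{0<..lb}. \<not> f_bar f y l < f_bar f x l)"
      using weak[OF xy(2), of x] by (simp add: prec_def not_less)
    then show "\<exists>lb>0. \<forall>l\<in>{0<..lb}. f_bar f x l > f_bar f y l"
      using definable_near_0_dichotomy[OF def_pred_f_bar_less[OF assms(1) D(2)], of y x] by blast
  next
    assume "\<exists>lb>0. \<forall>l\<in>{0<..lb}. f_bar f x l > f_bar f y l"
    then obtain lb where lb: "lb > 0" "\<And>l. l \<in> {0<..lb} \<Longrightarrow> f_bar f y l < f_bar f x l"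
      by blast
    have "preceq f x y"
      unfolding weak[OF xy(1)] using lb by (intro exI[of _ lb]) (auto intro: less_imp_le)
    moreover have "\<not> preceq f y x"
    proof
      assume "preceq f y x"
      then obtain lb' where lb': "lb' > 0" "\<And>l. l \<in> {0<..lb'} \<Longrightarrow> f_bar f x l \<le> f_bar f y l"
        unfolding weak[OF xy(2)] by blast
      \<comment> \<open>At this common level the strict and the opposite weak inequality
        collide.\<close>
      have "min lb lb' \<in> {0<..lb}" "min lb lb' \<in> {0<..lb'}"
        using lb(1) lb'(1) by auto
      with lb(2) lb'(2) show False
        by (meson not_less)
    qed
    ultimately show "prec f x y"
      by (simp add: prec_def)
  qed
  show ?thesis
    using weak strict by blast
qed

end
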